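(* Let $m,l\ge 1$ be integers, $M=ml$, and let $a_{-m},\dots,a_m$ be complex $l\times l$ matrices. Put $H(\beta)=\sum_{n=-m}^{m}a_n\beta^n$ and let $E\in\mathbb{C}$. Let $\beta_1,\dots,\beta_{2M}$ be the $2M$ roots of $\det[E-H(\beta)]=0$, where the root zero and the root at infinity are taken into account (see the context), and assume that they are nondegenerate, i.e. pairwise distinct. For each $i$ let $v_i,u_i\in\mathbb{C}^l$ be nonzero right and left generalized eigenvectors, $[E-H(\beta_i)]v_i=0$ and $u_i^T[E-H(\beta_i)]=0$, and define the supercell right and left generalized eigenvectors in $\mathbb{C}^M$ $$x_i=\begin{pmatrix}v_i\\ \beta_i^{-1}v_i\\ \vdots\\ \beta_i^{-(m-1)}v_i\end{pmatrix},\qquad y_i=\begin{pmatrix}u_i\\ \beta_i u_i\\ \vdots\\ \beta_i^{m-1}u_i\end{pmatrix}$$ (for $\beta_i\in\{0,\infty\}$ these are read as explained in the context). For every subset $P\subset\{1,\dots,2M\}$ with exactly $M$ elements let $F_P$ be the coefficient belonging to $\prod_{k\in P}(\beta_k)^L$ in the open-boundary equation $\sum_P F_P\prod_{k\in P}(\beta_k)^L=0$ of a chain of length $L$ (defined in the context). Then $$F_P\neq 0\iff \det\Big(\sum_{i\in P}x_iy_i^T\Big)\neq 0 .$$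
   Context: The matrices $a_n$ define a one-dimensional tight-binding operator acting on sequences $\psi(j)\in\mathbb{C}^l$ by $(H\psi)(j)=\sum_{n=-m}^m a_n\psi(j-n)$. It is considered on a chain of $L$ unit cells $j=1,\dots,L$ with open boundary conditions, i.e. $\psi(j)=0$ for $1-m\le j\le 0$ and for $L+1\le j\le L+m$. The ansatz $\psi(j)=\beta_i^{-j}v_i$ solves the bulk equation $H\psi=E\psi$. Roots at zero and infinity. Write $\beta=\lambda/\mu$ and $Q(\lambda,\mu)=E\lambda^m\mu^m-\sum_{n=-m}^m a_n\lambda^{m+n}\mu^{m-n}$. Then $\det Q$ is homogeneous of degree $2M$ (assumed not identically zero), and its $2M$ zeros $[\lambda_i:\mu_i]$ on the projective line are the roots $\beta_i=\lambda_i/\mu_i$, with $\beta=0$ for $\lambda=0$ and $\beta=\infty$ for $\mu=0$. The eigenvector equations mean $Q(\lambda_i,\mu_i)v_i=0$ and $u_i^TQ(\lambda_i,\mu_i)=0$; thus $a_{-m}v_i=0$, $u_i^Ta_{-m}=0$ if $\beta_i=0$, and $a_mv_i=0$, $u_i^Ta_m=0$ if $\beta_i=\infty$. The vectors $x_i,y_i$ matter only up to nonzero scalar factors. In homogeneous form, $x_i$ has blocks $\lambda_i^{m-1-p}\mu_i^{p}v_i$ and $y_i$ has blocks $\lambda_i^{p}\mu_i^{m-1-p}u_i$, $p=0,\dots,m-1$; for finite nonzero $\beta_i$ these are proportional to the displayed vectors, and for $m=1$ simply $x_i=v_i$, $y_i=u_i$. Coefficients $F_P$. Superpose the $2M$ modes,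 $\psi=\sum_i c_i\psi_i$. Up to nonzero scalars, $\psi_i$ restricted to the $m$ cells left of the chain is $\beta_i^{L+m}x_i$ and restricted to the $m$ cells right of the chain is $x_i$ (homogeneously: $\lambda_i^{L+m}x_i$ and $\mu_i^{L+m}x_i$). A nonzero solution $(c_i)$ of the boundary conditions exists iff the $2M\times 2M$ determinant with columns $\begin{pmatrix}\lambda_i^{L+m}x_i\\ \mu_i^{L+m}x_i\end{pmatrix}$ vanishes. For indeterminates $z_1,\dots,z_{2M}$, expand $$\det\begin{pmatrix}z_1x_1&\cdots&z_{2M}x_{2M}\\ x_1&\cdots&x_{2M}\end{pmatrix}=\sum_{P}F_P\prod_{k\in P}z_k ,$$ the sum being over $M$-element subsets $P$ of $\{1,\dots,2M\}$; this defines $F_P$. Inserting $z_k=\beta_k^{L+m}$ gives the open-boundary equation (the $L$-independent factors $\beta_k^m$ are not counted in $F_P$). *)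

theory Defs
  imports "Jordan_Normal_Form.Determinant" "HOL-Library.Poly_Mapping"
begin

definition bloch_mat :: "(int \<Rightarrow> complex mat) \<Rightarrow> nat \<Rightarrow> nat \<Rightarrow> complex \<Rightarrow> complex mat" where
  "bloch_mat a m l \<beta> =
     mat l l (\<lambda>(r, s). \<Sum>n = - int m..int m. a n $$ (r, s) * \<beta> powi n)"

definition pencil :: "(int \<Rightarrow> complex mat) \<Rightarrow> nat \<Rightarrow> nat \<Rightarrow> complex \<Rightarrow> complex \<Rightarrow> complex \<Rightarrow> complex mat" where
  "pencil a m l E lam mu =
     (E * lam ^ m * mu ^ m) \<cdot>\<^sub>m 1\<^sub>m l
     - mat l l (\<lambda>(r, s). \<Sum>n = - int m..int m.
         a n $$ (r, s) * lam ^ nat (int m + n) * mu ^ nat (int m - n))"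

text \<open>A root is a point \<open>[lam : mu]\<close> of the projective line, standing for
  \<open>\<beta> = lam / mu\<close>; the root at infinity has \<open>mu = 0\<close>. The supercell vectors have
  \<open>m\<close> blocks of length \<open>l\<close>: entry \<open>j\<close> lies in block \<open>j div l\<close>. For finite nonzero
  \<open>\<beta>\<close> they are proportional to the vectors with blocks \<open>\<beta> ^ (-p) v\<close> and
  \<open>\<beta> ^ p u\<close>.\<close>

definition supercell_right :: "nat \<Rightarrow> nat \<Rightarrow> complex \<Rightarrow> complex \<Rightarrow> complex vec \<Rightarrow> complex vec" where
  "supercell_right m l lam mu v =
     vec (m * l) (\<lambda>j. lam ^ (m - 1 - j div l) * mu ^ (j div l) * v $ (j mod l))"

definition supercell_left :: "nat \<Rightarrow> nat \<Rightarrow> complex \<Rightarrow> complex \<Rightarrow> complex vec \<Rightarrow> complex vec" where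
  "supercell_left m l lam mu u =
     vec (m * l) (\<lambda>j. lam ^ (j div l) * mu ^ (m - 1 - j div l) * u $ (j mod l))"

definition outer_sum :: "nat \<Rightarrow> nat set \<Rightarrow> (nat \<Rightarrow> complex vec) \<Rightarrow> (nat \<Rightarrow> complex vec) \<Rightarrow> complex mat" where
  "outer_sum M P x y = mat M M (\<lambda>(r, s). \<Sum>i\<in>P. x i $ r * y i $ s)"

definition boundary_mat :: "nat \<Rightarrow> (nat \<Rightarrow> 'a::comm_ring_1) \<Rightarrow> (nat \<Rightarrow> 'a vec) \<Rightarrow> 'a mat" where
  "boundary_mat M z x =
     mat (2 * M) (2 * M) (\<lambda>(r, k). if r < M then z k * x k $ r else x k $ (r - M))"

text \<open>Polynomials in indeterminates indexed by \<open>nat\<close>: finitely supported maps from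
  monomials (finitely supported exponent maps) to coefficients.\<close>

type_synonym mpoly_complex = "(nat \<Rightarrow>\<^sub>0 nat) \<Rightarrow>\<^sub>0 complex"

definition indet :: "nat \<Rightarrow> mpoly_complex" where
  "indet k = Poly_Mapping.single (Poly_Mapping.single k 1) 1"

definition const_mpoly :: "complex \<Rightarrow> mpoly_complex" where
  "const_mpoly c = Poly_Mapping.single 0 c"

definition boundary_coeff :: "nat \<Rightarrow> (nat \<Rightarrow> complex vec) \<Rightarrow> nat set \<Rightarrow> complex" where
  "boundary_coeff M x P =
     Poly_Mapping.lookup (det (boundary_mat M indet (\<lambda>k. map_vec const_mpoly (x k))))
       (\<Sum>k\<in>P. Poly_Mapping.single k 1)"

lemma pencil_eq_bloch:
  assumes "lam \<noteq> 0" "mu \<noteq> 0"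
  shows "pencil a m l E lam mu = (lam * mu) ^ m \<cdot>\<^sub>m (E \<cdot>\<^sub>m 1\<^sub>m l - bloch_mat a m l (lam / mu))"
proof -
  have *: "lam ^ nat (int m + n) * mu ^ nat (int m - n) = (lam * mu) ^ m * (lam / mu) powi n"
    if "n \<in> {- int m..int m}" for n
  proof -
    have "lam ^ nat (int m + n) = lam powi (int m + n)" "mu ^ nat (int m - n) = mu powi (int m - n)"
      using that by (auto simp: power_int_def)
    then show ?thesis
      using assms by (simp add: power_int_add power_int_diff power_int_divide_distrib power_mult_distrib)
  qed
  have "(\<Sum>n = - int m..int m. a n $$ (r, s) * lam ^ nat (int m + n) * mu ^ nat (int m - n))
    = (lam * mu) ^ m * (\<Sum>n = - int m..int m. a n $$ (r, s) * (lam / mu) powi n)" for r s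
    unfolding sum_distrib_left by (rule sum.cong) (auto simp: * mult.assoc mult.left_commute)
  then show ?thesis
    by (intro eq_matI)
       (auto simp: pencil_def bloch_mat_def algebra_simps power_mult_distrib)
qed

lemma supercell_right_eq:
  assumes "lam \<noteq> 0" "mu \<noteq> 0"
  shows "supercell_right m l lam mu v =
    lam ^ (m - 1) \<cdot>\<^sub>v vec (m * l) (\<lambda>j. (lam / mu) powi (- int (j div l)) * v $ (j mod l))"
proof (intro eq_vecI)
  fix j assume "j < dim_vec (lam ^ (m - 1) \<cdot>\<^sub>v
    vec (m * l) (\<lambda>j. (lam / mu) powi (- int (j div l)) * v $ (j mod l)))"
  then have j: "j < m * l" by simp
  then have "j div l < m"
    by (simp add: less_mult_imp_div_less)
  then have "lam ^ (m - 1) = lam ^ (m - 1 - j div l) * lam ^ (j div l)"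
    by (simp flip: power_add)
  then show "supercell_right m l lam mu v $ j = (lam ^ (m - 1) \<cdot>\<^sub>v
    vec (m * l) (\<lambda>j. (lam / mu) powi (- int (j div l)) * v $ (j mod l))) $ j"
    using j assms by (simp add: supercell_right_def power_int_minus power_divide)
qed (simp add: supercell_right_def)

lemma supercell_left_eq:
  assumes "lam \<noteq> 0" "mu \<noteq> 0"
  shows "supercell_left m l lam mu u =
    mu ^ (m - 1) \<cdot>\<^sub>v vec (m * l) (\<lambda>j. (lam / mu) ^ (j div l) * u $ (j mod l))"
proof (intro eq_vecI)
  fix j assume "j < dim_vec (mu ^ (m - 1) \<cdot>\<^sub>v
    vec (m * l) (\<lambda>j. (lam / mu) ^ (j div l) * u $ (j mod l)))"
  then have j: "j < m * l" by simp
  then have "j div l < m"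
    by (simp add: less_mult_imp_div_less)
  then have "mu ^ (m - 1) = mu ^ (m - 1 - j div l) * mu ^ (j div l)"
    by (simp flip: power_add)
  then show "supercell_left m l lam mu u $ j = (mu ^ (m - 1) \<cdot>\<^sub>v
    vec (m * l) (\<lambda>j. (lam / mu) ^ (j div l) * u $ (j mod l))) $ j"
    using j assms by (simp add: supercell_left_def power_divide)
qed (simp add: supercell_left_def)

lemma boundary_mat_prod:
  fixes z :: "nat \<Rightarrow> 'a::comm_ring_1"
  assumes p: "p permutes {0..<2 * M}"
  shows "(\<Prod>r = 0..<2 * M. boundary_mat M z x $$ (r, p r)) =
    (\<Prod>k\<in>p ` {..<M}. z k) *
    (\<Prod>r = 0..<2 * M. x (p r) $ (if r < M then r else r - M))"
proof -
  have inj: "inj_on p {..<M}"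
    using permutes_inj[OF p] by (rule inj_on_subset) simp
  have "(\<Prod>r = 0..<2 * M. boundary_mat M z x $$ (r, p r)) =
    (\<Prod>r = 0..<2 * M. (if r < M then z (p r) else 1) * x (p r) $ (if r < M then r else r - M))"
  proof (rule prod.cong)
    fix r assume r: "r \<in> {0..<2 * M}"
    then have "p r < 2 * M" using permutes_in_image[OF p, of r] by simp
    then show "boundary_mat M z x $$ (r, p r) =
      (if r < M then z (p r) else 1) * x (p r) $ (if r < M then r else r - M)"
      using r by (simp add: boundary_mat_def)
  qed simp
  also have "\<dots> = (\<Prod>r = 0..<2 * M. if r < M then z (p r) else 1) *
    (\<Prod>r = 0..<2 * M. x (p r) $ (if r < M then r else r - M))"
    by (rule prod.distrib)
  also have "(\<Prod>r = 0..<2 * M. if r < M then z (p r) else 1) = (\<Prod>r\<in>{..<M}. z (p r))"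
    by (rule prod.mono_neutral_cong_right) auto
  also have "\<dots> = (\<Prod>k\<in>p ` {..<M}. z k)"
    using prod.reindex[OF inj, of z] by simp
  finally show ?thesis .
qed

lemma const_mpoly_simps:
  "const_mpoly (a * b) = const_mpoly a * const_mpoly b"
  "const_mpoly 1 = 1"
  "const_mpoly (- a) = - const_mpoly a"
  by (simp_all add: const_mpoly_def mult_single single_uminus flip: single_one)

lemma const_mpoly_prod: "const_mpoly (prod f A) = (\<Prod>i\<in>A. const_mpoly (f i))"
  by (induction A rule: infinite_finite_induct) (simp_all add: const_mpoly_simps)

lemma signof_times_single:
  "signof p * (Poly_Mapping.single t c :: mpoly_complex) = Poly_Mapping.single t (signof p * c)"
  by (simp add: sign_def single_uminus)

lemma prod_indet:
  "finite A \<Longrightarrow> (\<Prod>k\<in>A. indet k) = Poly_Mapping.single (\<Sum>k\<in>A. Poly_Mapping.single k 1) 1"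
  by (induction A rule: finite_induct) (simp_all add: indet_def mult_single)

lemma lookup_monomial:
  assumes "finite A"
  shows "Poly_Mapping.lookup (\<Sum>k\<in>A. Poly_Mapping.single k (1::nat)) j = (if j \<in> A then 1 else 0)"
  using assms
  by (induction A rule: finite_induct) (auto simp: lookup_add lookup_single when_def)

lemma monomial_eq_iff:
  assumes "finite A" "finite B"
  shows "(\<Sum>k\<in>A. Poly_Mapping.single k (1::nat)) = (\<Sum>k\<in>B. Poly_Mapping.single k 1) \<longleftrightarrow> A = B"
proof
  assume "(\<Sum>k\<in>A. Poly_Mapping.single k (1::nat)) = (\<Sum>k\<in>B. Poly_Mapping.single k 1)"
  then have "j \<in> A \<longleftrightarrow> j \<in> B" for j
    using lookup_monomial[OF assms(1), of j] lookup_monomial[OF assms(2), of j]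
    by (metis zero_neq_one)
  then show "A = B" by blast
qed simp

lemma boundary_coeff_leibniz:
  assumes x: "\<And>k. k < 2 * M \<Longrightarrow> x k \<in> carrier_vec M" and P: "finite P"
  shows "boundary_coeff M x P =
    (\<Sum>p | p permutes {0..<2 * M} \<and> p ` {..<M} = P.
      signof p * (\<Prod>r = 0..<2 * M. x (p r) $ (if r < M then r else r - M)))"
proof -
  define g where "g p = (\<Prod>r = 0..<2 * M. x (p r) $ (if r < M then r else r - M))" for p
  define S where "S = {p. p permutes {0..<2 * M}}"
  have fS: "finite S" unfolding S_def by (rule finite_permutations) simp
  let ?X = "\<lambda>k. map_vec const_mpoly (x k)"
  let ?B = "boundary_mat M indet ?X"
  have "?B \<in> carrier_mat (2 * M) (2 * M)" by (simp add: boundary_mat_def)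
  then have "det ?B = (\<Sum>p\<in>S. signof p * (\<Prod>r = 0..<2 * M. ?B $$ (r, p r)))"
    unfolding S_def by (rule det_def')
  also have "\<dots> = (\<Sum>p\<in>S. Poly_Mapping.single (\<Sum>k\<in>p ` {..<M}. Poly_Mapping.single k 1) (signof p * g p))"
  proof (rule sum.cong)
    fix p assume "p \<in> S"
    then have p: "p permutes {0..<2 * M}" by (simp add: S_def)
    have "(\<Prod>r = 0..<2 * M. ?X (p r) $ (if r < M then r else r - M)) = const_mpoly (g p)"
      unfolding g_def const_mpoly_prod
    proof (rule prod.cong)
      fix r assume r: "r \<in> {0..<2 * M}"
      then have "p r < 2 * M" using permutes_in_image[OF p, of r] by simp
      then have "dim_vec (x (p r)) = M" by (rule carrier_vecD[OF x])
      then show "?X (p r) $ (if r < M then r else r - M) =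
        const_mpoly (x (p r) $ (if r < M then r else r - M))"
        using r by simp
    qed simp
    then have "(\<Prod>r = 0..<2 * M. ?B $$ (r, p r)) =
      Poly_Mapping.single (\<Sum>k\<in>p ` {..<M}. Poly_Mapping.single k 1) (g p)"
      unfolding boundary_mat_prod[OF p] by (simp add: prod_indet const_mpoly_def mult_single)
    then show "signof p * (\<Prod>r = 0..<2 * M. ?B $$ (r, p r)) =
      Poly_Mapping.single (\<Sum>k\<in>p ` {..<M}. Poly_Mapping.single k 1) (signof p * g p)"
      by (simp only: signof_times_single)
  qed simp
  finally have "boundary_coeff M x P = (\<Sum>p\<in>S. if p ` {..<M} = P then signof p * g p else 0)"
    unfolding boundary_coeff_def
    by (simp add: lookup_sum lookup_single when_def
        monomial_eq_iff[OF _ P, unfolded One_nat_def])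
  also have "\<dots> = (\<Sum>p\<in>{p\<in>S. p ` {..<M} = P}. signof p * g p)"
    using fS by (simp add: sum.inter_filter)
  finally show ?thesis by (simp add: S_def g_def)
qed

text \<open>The determinant contains only monomials belonging to \<open>M\<close>-element sets.\<close>

lemma det_boundary_mat_expansion:
  fixes z :: "nat \<Rightarrow> complex"
  assumes x: "\<And>k. k < 2 * M \<Longrightarrow> x k \<in> carrier_vec M"
  shows "det (boundary_mat M z x) =
    (\<Sum>P | P \<subseteq> {..<2 * M} \<and> card P = M. boundary_coeff M x P * (\<Prod>k\<in>P. z k))"
proof -
  define g where "g p = (\<Prod>r = 0..<2 * M. x (p r) $ (if r < M then r else r - M))" for p
  define S where "S = {p. p permutes {0..<2 * M}}"
  define T where "T = {P. P \<subseteq> {..<2 * M} \<and> card P = M}"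
  have fS: "finite S" unfolding S_def by (rule finite_permutations) simp
  have fT: "finite T" unfolding T_def by (rule finite_subset[of _ "Pow {..<2 * M}"]) auto
  have ST: "(\<lambda>p. p ` {..<M}) ` S \<subseteq> T"
  proof safe
    fix p assume "p \<in> S"
    then have p: "p permutes {0..<2 * M}" by (simp add: S_def)
    have "p k < 2 * M" if "k < M" for k
      using permutes_in_image[OF p, of k] that by simp
    then have "p ` {..<M} \<subseteq> {..<2 * M}" by blast
    moreover have "card (p ` {..<M}) = M"
      using card_image[OF inj_on_subset[OF permutes_inj[OF p], of "{..<M}"]] by simp
    ultimately show "p ` {..<M} \<in> T" by (simp add: T_def)
  qed
  have "boundary_mat M z x \<in> carrier_mat (2 * M) (2 * M)" by (simp add: boundary_mat_def)
  then have "det (boundary_mat M z x) =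
    (\<Sum>p\<in>S. signof p * (\<Prod>r = 0..<2 * M. boundary_mat M z x $$ (r, p r)))"
    unfolding S_def by (rule det_def')
  also have "\<dots> = (\<Sum>p\<in>S. signof p * g p * (\<Prod>k\<in>p ` {..<M}. z k))"
  proof (rule sum.cong)
    fix p assume "p \<in> S"
    then have p: "p permutes {0..<2 * M}" by (simp add: S_def)
    show "signof p * (\<Prod>r = 0..<2 * M. boundary_mat M z x $$ (r, p r)) =
      signof p * g p * (\<Prod>k\<in>p ` {..<M}. z k)"
      unfolding boundary_mat_prod[OF p] g_def by (simp only: mult_ac)
  qed simp
  also have "\<dots> = (\<Sum>P\<in>T. \<Sum>p | p \<in> S \<and> p ` {..<M} = P. signof p * g p * (\<Prod>k\<in>p ` {..<M}. z k))"
    by (rule sum.group[OF fS fT ST, symmetric])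
  also have "\<dots> = (\<Sum>P\<in>T. boundary_coeff M x P * (\<Prod>k\<in>P. z k))"
  proof (rule sum.cong)
    fix P assume "P \<in> T"
    then have "finite P" by (auto simp: T_def intro: finite_subset)
    from boundary_coeff_leibniz[OF x this]
    show "(\<Sum>p | p \<in> S \<and> p ` {..<M} = P. signof p * g p * (\<Prod>k\<in>p ` {..<M}. z k)) =
      boundary_coeff M x P * (\<Prod>k\<in>P. z k)"
      by (simp add: S_def g_def sum_distrib_right)
  qed simp
  finally show ?thesis by (simp add: T_def)
qed

end

theory Submission
  imports Defs
begin

text \<open>Setting \<open>z k\<close> to the indicator of \<open>P\<close> shows that \<open>F_P\<close> is, up to sign,
  \<open>det X_P det X_Q\<close>, where \<open>Q\<close> is the complement of \<open>P\<close> and the columns of \<open>X_P\<close> are the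
  \<open>x i\<close>, \<open>i \<in> P\<close>; and \<open>\<Sum>i\<in>P. x i (y i)\<^sup>T\<close> has determinant \<open>det X_P det Y_P\<close>. So \<open>det X_Q\<close> has
  to be compared with \<open>det Y_P\<close>. After a projective change of coordinate all roots are finite;
  they are simple, so the residues of the inverse of the pencil are nonzero multiples of
  \<open>v i (u i)\<^sup>T\<close>, and the residue theorem yields nonzero \<open>d i\<close> with \<open>\<Sum>i. d i x i (y i)\<^sup>T = 0\<close>, the
  sum being over all \<open>2 M\<close> roots. The \<open>y i\<close> span, so this duality makes complementary minors of
  \<open>X\<close> and \<open>Y\<close> vanish together.\<close>

section \<open>Maximal minors as separation properties\<close>

text \<open>Kernel vectors are plain functions of the index, so that the later arguments are
  manipulations of finite sums.\<close>

lemma det_eq_0_iff_kernel: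
  fixes A :: "'a::idom mat"
  assumes A: "A \<in> carrier_mat n n"
  shows "det A = 0 \<longleftrightarrow> (\<exists>w. (\<exists>j<n. w j \<noteq> 0) \<and> (\<forall>r<n. (\<Sum>s<n. A $$ (r, s) * w s) = 0))"
proof
  assume "det A = 0"
  then obtain z where z: "z \<in> carrier_vec n" "z \<noteq> 0\<^sub>v n" "A *\<^sub>v z = 0\<^sub>v n"
    using det_0_iff_vec_prod_zero[OF A] by auto
  have "\<exists>j<n. z $ j \<noteq> 0"
    using z(1,2) by (metis carrier_vecD eq_vecI index_zero_vec)
  moreover have "(\<Sum>s<n. A $$ (r, s) * z $ s) = 0" if "r < n" for r
  proof -
    have "(\<Sum>s<n. A $$ (r, s) * z $ s) = (A *\<^sub>v z) $ r"
      using that A z(1) by (simp add: scalar_prod_def atLeast0LessThan)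
    then show ?thesis using z(3) that by simp
  qed
  ultimately show "\<exists>w. (\<exists>j<n. w j \<noteq> 0) \<and> (\<forall>r<n. (\<Sum>s<n. A $$ (r, s) * w s) = 0)"
    by (intro exI[of _ "\<lambda>j. z $ j"]) auto
next
  assume "\<exists>w. (\<exists>j<n. w j \<noteq> 0) \<and> (\<forall>r<n. (\<Sum>s<n. A $$ (r, s) * w s) = 0)"
  then obtain w j where w: "j < n" "w j \<noteq> 0" "\<And>r. r < n \<Longrightarrow> (\<Sum>s<n. A $$ (r, s) * w s) = 0"
    by auto
  have "vec n w \<noteq> 0\<^sub>v n" using w(1,2) by (metis index_vec index_zero_vec(1))
  moreover have "A *\<^sub>v vec n w = 0\<^sub>v n"
    using A w(3) by (intro eq_vecI) (auto simp: scalar_prod_def atLeast0LessThan)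
  ultimately show "det A = 0"
    using det_0_iff_vec_prod_zero[OF A] vec_carrier by blast
qed

text \<open>Dual form of spanning: no nonzero linear form annihilates all \<open>x k\<close>. For
  \<open>card P = M\<close> this says that the minor with columns \<open>P\<close> is nonzero, but
  it requires no ordering of \<open>P\<close> and makes sense for larger sets too.\<close>

definition separating :: "nat \<Rightarrow> nat set \<Rightarrow> (nat \<Rightarrow> complex vec) \<Rightarrow> bool" where
  "separating M P x \<longleftrightarrow>
     (\<forall>w. (\<forall>k\<in>P. (\<Sum>r<M. w r * x k $ r) = 0) \<longrightarrow> (\<forall>r<M. w r = 0))"

lemma separatingD:
  assumes "separating M P x" "\<And>k. k \<in> P \<Longrightarrow> (\<Sum>r<M. w r * x k $ r) = 0" "r < M"
  shows "w r = 0"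
  using assms unfolding separating_def by blast

text \<open>Spanning \<open>M\<close> vectors in dimension \<open>M\<close> are independent: with
  \<open>P\<close> enumerated, a relation makes the square matrix of columns singular, hence also
  its transpose, whose kernel vector is a linear form annihilating all columns.\<close>

lemma separating_imp_independent:
  assumes sep: "separating M P x" and P: "finite P" "card P = M"
    and c: "\<And>r. r < M \<Longrightarrow> (\<Sum>k\<in>P. c k * x k $ r) = 0" and k: "k \<in> P"
  shows "c k = 0"
proof (rule ccontr)
  assume ck: "c k \<noteq> 0"
  obtain e where e: "bij_betw e {..<M} P"
    using ex_bij_betw_nat_finite[OF P(1)] P(2) by (auto simp: atLeast0LessThan)
  define A where "A = mat M M (\<lambda>(r, s). x (e s) $ r)"
  have A: "A \<in> carrier_mat M M" by (simp add: A_def)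
  obtain j where j: "j < M" "e j = k" using e k by (auto simp: bij_betw_def)
  have "det A = 0"
    unfolding det_eq_0_iff_kernel[OF A]
  proof (intro exI[of _ "\<lambda>s. c (e s)"] conjI allI impI)
    fix r assume r: "r < M"
    have "(\<Sum>s<M. A $$ (r, s) * c (e s)) = (\<Sum>s<M. c (e s) * x (e s) $ r)"
      using r by (simp add: A_def mult.commute)
    also have "\<dots> = (\<Sum>k\<in>P. c k * x k $ r)"
      using sum.reindex_bij_betw[OF e] .
    finally show "(\<Sum>s<M. A $$ (r, s) * c (e s)) = 0" using c[OF r] by simp
  qed (use j ck in auto)
  then have "det A\<^sup>T = 0" using det_transpose[OF A] by simp
  then obtain w i where i: "i < M" "w i \<noteq> 0"
    and w: "\<And>r. r < M \<Longrightarrow> (\<Sum>s<M. A\<^sup>T $$ (r, s) * w s) = 0"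
    using A by (auto simp: det_eq_0_iff_kernel[of "A\<^sup>T" M])
  have "w i = 0"
  proof (rule separatingD[OF sep _ i(1)])
    fix k assume "k \<in> P"
    then obtain j where j: "j < M" "e j = k" using e by (auto simp: bij_betw_def)
    show "(\<Sum>r<M. w r * x k $ r) = 0"
      using w[OF j(1)] j by (simp add: A_def mult.commute)
  qed
  then show False using i by simp
qed

text \<open>A form annihilating all \<open>x i\<close> or all \<open>y i\<close> lies in the left or
  right kernel. Conversely, a right kernel vector \<open>w\<close> gives a relation among the
  \<open>x i\<close> with coefficients \<open>w\<close> paired with \<open>y i\<close>; independence
  makes these zero.\<close>

lemma det_outer_sum_ne_0_iff:
  assumes P: "finite P" "card P = M"
  shows "det (outer_sum M P x y) \<noteq> 0 \<longleftrightarrow> separating M P x \<and> separating M P y"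
proof -
  let ?A = "outer_sum M P x y"
  have A: "?A \<in> carrier_mat M M" by (simp add: outer_sum_def)
  have row: "(\<Sum>s<M. ?A $$ (r, s) * w s) = (\<Sum>i\<in>P. (\<Sum>s<M. w s * y i $ s) * x i $ r)"
    if "r < M" for r w
    using that
    by (simp add: outer_sum_def sum_distrib_right sum_distrib_left mult_ac)
       (rule sum.swap)
  have col: "(\<Sum>s<M. ?A $$ (s, r) * w s) = (\<Sum>i\<in>P. (\<Sum>s<M. w s * x i $ s) * y i $ r)"
    if "r < M" for r w
    using that
    by (simp add: outer_sum_def sum_distrib_right sum_distrib_left mult_ac)
       (rule sum.swap)
  show ?thesis
  proof (intro iffI conjI)
    assume d: "det ?A \<noteq> 0"
    show "separating M P x"
    proof (rule ccontr)
      assume "\<not> separating M P x"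
      then obtain w where "\<exists>r<M. w r \<noteq> 0" "\<And>k. k \<in> P \<Longrightarrow> (\<Sum>r<M. w r * x k $ r) = 0"
        unfolding separating_def by blast
      then have "det ?A\<^sup>T = 0"
        using A by (subst det_eq_0_iff_kernel[of _ M]) (auto simp: col intro!: exI[of _ w])
      then show False using d det_transpose[OF A] by simp
    qed
    show "separating M P y"
    proof (rule ccontr)
      assume "\<not> separating M P y"
      then obtain w where "\<exists>r<M. w r \<noteq> 0" "\<And>k. k \<in> P \<Longrightarrow> (\<Sum>r<M. w r * y k $ r) = 0"
        unfolding separating_def by blast
      then have "det ?A = 0"
        using A by (subst det_eq_0_iff_kernel[of _ M]) (auto simp: row intro!: exI[of _ w])
      then show False using d by simp
    qed
  next
    assume s: "separating M P x \<and> separating M P y"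
    show "det ?A \<noteq> 0"
    proof
      assume "det ?A = 0"
      then obtain w j where j: "j < M" "w j \<noteq> 0"
        and w: "\<And>r. r < M \<Longrightarrow> (\<Sum>s<M. ?A $$ (r, s) * w s) = 0"
        unfolding det_eq_0_iff_kernel[OF A] by blast
      have "(\<Sum>s<M. w s * y i $ s) = 0" if "i \<in> P" for i
        by (rule separating_imp_independent[OF conjunct1[OF s] P _ that]) (use w row in auto)
      then have "w j = 0" using separatingD[OF conjunct2[OF s] _ j(1)] by blast
      then show False using j by simp
    qed
  qed
qed

text \<open>Putting \<open>z k = 1\<close> for \<open>k \<in> P\<close> and \<open>z k = 0\<close> otherwise kills every monomial except
  the one of \<open>P\<close>.\<close>

lemma boundary_coeff_eq_det:
  assumes x: "\<And>k. k < 2 * M \<Longrightarrow> x k \<in> carrier_vec M"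
    and P: "P \<subseteq> {..<2 * M}" "card P = M"
  shows "boundary_coeff M x P = det (boundary_mat M (\<lambda>k. if k \<in> P then 1 else 0) x)"
proof -
  let ?z = "\<lambda>k. if k \<in> P then 1 else (0::complex)"
  define T where "T = {P. P \<subseteq> {..<2 * M} \<and> card P = M}"
  have fT: "finite T" unfolding T_def by (rule finite_subset[of _ "Pow {..<2 * M}"]) auto
  have fP: "finite P" using P(1) finite_subset by blast
  have "(\<Prod>k\<in>P'. ?z k) = (if P' = P then 1 else 0)" if "P' \<in> T" for P'
  proof (cases "P' = P")
    case False
    have fin: "finite P'" using that finite_subset by (auto simp: T_def)
    have "\<not> P' \<subseteq> P"
      using card_subset_eq[OF fP, of P'] that P(2) False by (auto simp: T_def)
    then show ?thesis using False fin by (auto simp: prod_zero_iff)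
  qed simp
  then have "(\<Sum>P'\<in>T. boundary_coeff M x P' * (\<Prod>k\<in>P'. ?z k)) =
    (\<Sum>P'\<in>T. if P' = P then boundary_coeff M x P' else 0)"
    by (intro sum.cong) auto
  also have "\<dots> = boundary_coeff M x P" using fT P by (simp add: T_def)
  finally show ?thesis by (simp add: det_boundary_mat_expansion[OF x] T_def)
qed

text \<open>For the indicator of \<open>P\<close>, the columns are \<open>(x k, x k)\<close> inside
  \<open>P\<close> and \<open>(0, x k)\<close> outside. Up to row operations the matrix is block
  triangular, with the columns of \<open>P\<close> and of its complement as diagonal blocks.\<close>

lemma boundary_coeff_ne_0_iff:
  assumes x: "\<And>k. k < 2 * M \<Longrightarrow> x k \<in> carrier_vec M"
    and P: "P \<subseteq> {..<2 * M}" "card P = M"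
  shows "boundary_coeff M x P \<noteq> 0 \<longleftrightarrow>
    separating M P x \<and> separating M ({..<2 * M} - P) x"
proof -
  let ?z = "\<lambda>k. if k \<in> P then 1 else (0::complex)"
  let ?B = "boundary_mat M ?z x"
  let ?Q = "{..<2 * M} - P"
  have B: "?B \<in> carrier_mat (2 * M) (2 * M)" by (simp add: boundary_mat_def)
  have split: "(\<Sum>r<2 * M. g r) = (\<Sum>r<M. g r) + (\<Sum>r<M. g (M + r))" for g :: "nat \<Rightarrow> complex"
  proof -
    have "(\<Sum>r<2 * M. g r) = (\<Sum>r\<in>{0..<M + M}. g r)"
      by (simp add: mult_2 atLeast0LessThan)
    also have "\<dots> = (\<Sum>r\<in>{0..<M}. g r) + (\<Sum>r\<in>{M..<M + M}. g r)"
      by (simp add: sum.atLeastLessThan_concat)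
    also have "(\<Sum>r\<in>{M..<M + M}. g r) = (\<Sum>r\<in>{0..<M}. g (M + r))"
      using sum.shift_bounds_nat_ivl[of g 0 M M] by (simp add: add.commute)
    finally show ?thesis by (simp add: atLeast0LessThan)
  qed
  have col: "(\<Sum>s<2 * M. ?B\<^sup>T $$ (k, s) * w s) =
      ?z k * (\<Sum>r<M. w r * x k $ r) + (\<Sum>r<M. w (M + r) * x k $ r)"
    if "k < 2 * M" for k w
    unfolding split using that by (simp add: boundary_mat_def sum_distrib_left mult_ac)
  have "det ?B\<^sup>T \<noteq> 0 \<longleftrightarrow> separating M P x \<and> separating M ?Q x"
  proof (intro iffI conjI)
    assume d: "det ?B\<^sup>T \<noteq> 0"
    have null: "w r = 0" if "r < 2 * M"
      "\<And>k. k < 2 * M \<Longrightarrow> ?z k * (\<Sum>r<M. w r * x k $ r) + (\<Sum>r<M. w (M + r) * x k $ r) = 0" for w r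
    proof (rule ccontr)
      assume "w r \<noteq> 0"
      moreover have "\<forall>k<2 * M. (\<Sum>s<2 * M. ?B\<^sup>T $$ (k, s) * w s) = 0"
        using col[of _ w] that(2) by simp
      ultimately have "det ?B\<^sup>T = 0"
        using that(1) det_eq_0_iff_kernel[OF iffD2[OF transpose_carrier_mat B]] by blast
      then show False using d by simp
    qed
    show "separating M P x"
      unfolding separating_def
    proof (intro allI impI)
      fix w :: "nat \<Rightarrow> complex" and r
      assume w: "\<forall>k\<in>P. (\<Sum>r<M. w r * x k $ r) = 0" and r: "r < M"
      show "w r = 0"
        using null[of r "\<lambda>r. if r < M then w r else 0"] w r by simp
    qed
    show "separating M ?Q x"
      unfolding separating_def
    proof (intro allI impI)
      fix w :: "nat \<Rightarrow> complex" and r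
      assume w: "\<forall>k\<in>?Q. (\<Sum>r<M. w r * x k $ r) = 0" and r: "r < M"
      \<comment> \<open>The form \<open>(w, - w)\<close> annihilates every column
        \<open>(x k, x k)\<close> and pairs with \<open>(0, x k)\<close> to the negative of
        \<open>w\<close> paired with \<open>x k\<close>.\<close>
      show "w r = 0"
        using null[of r "\<lambda>r. if r < M then w r else - w (r - M)"] w r
        by (simp add: sum_negf)
    qed
  next
    assume s: "separating M P x \<and> separating M ?Q x"
    show "det ?B\<^sup>T \<noteq> 0"
    proof
      assume "det ?B\<^sup>T = 0"
      then obtain w j where j: "j < 2 * M" "w j \<noteq> 0"
        and w: "\<And>k. k < 2 * M \<Longrightarrow> (\<Sum>s<2 * M. ?B\<^sup>T $$ (k, s) * w s) = 0"
        using B by (auto simp: det_eq_0_iff_kernel[of "?B\<^sup>T" "2 * M"])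
      \<comment> \<open>Columns outside \<open>P\<close> see only the lower half of
        \<open>w\<close>; once it vanishes, the columns in \<open>P\<close> see only the upper
        half.\<close>
      have lower: "w (M + r) = 0" if "r < M" for r
      proof (rule separatingD[OF conjunct2[OF s] _ that, of "\<lambda>r. w (M + r)"])
        fix k assume "k \<in> ?Q"
        then show "(\<Sum>r<M. w (M + r) * x k $ r) = 0" using w[of k] col[of k w] by simp
      qed
      have upper: "w r = 0" if "r < M" for r
      proof (rule separatingD[OF conjunct1[OF s] _ that])
        fix k assume "k \<in> P"
        then show "(\<Sum>r<M. w r * x k $ r) = 0"
          using w[of k] col[of k w] lower P(1) by auto
      qed
      have "j < M \<or> j - M < M \<and> M + (j - M) = j" using j(1) by linarith
      then show False using j(2) upper[of j] lower[of "j - M"] by auto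
    qed
  qed
  then show ?thesis using boundary_coeff_eq_det[OF x P] det_transpose[OF B] by simp
qed

text \<open>If \<open>X D Y\<^sup>T = 0\<close> for an invertible diagonal \<open>D\<close> and
  \<open>M \<times> 2 M\<close> matrices of full rank, the row spaces of \<open>X D\<close> and \<open>Y\<close> are orthogonal complements, and complementary maximal minors
  of \<open>X\<close> and \<open>Y\<close> vanish together.\<close>

lemma separating_complement_iff:
  assumes P: "P \<subseteq> {..<2 * M}" "card P = M"
    and d: "\<And>i. i < 2 * M \<Longrightarrow> d i \<noteq> 0"
    and orth: "\<And>r s. r < M \<Longrightarrow> s < M \<Longrightarrow> (\<Sum>i<2 * M. d i * x i $ r * y i $ s) = 0"
    and y: "separating M {..<2 * M} y"
    and xP: "separating M P x"
  shows "separating M ({..<2 * M} - P) x \<longleftrightarrow> separating M P y"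
proof
  let ?Q = "{..<2 * M} - P"
  have fin: "finite P" "finite ?Q" using P(1) finite_subset by auto
  have cQ: "card ?Q = M" using P fin by (simp add: card_Diff_subset)
  have split: "(\<Sum>i<2 * M. g i) = (\<Sum>i\<in>P. g i) + (\<Sum>i\<in>?Q. g i)" for g :: "nat \<Rightarrow> complex"
    using sum.subset_diff[OF P(1), of g] by (simp add: add.commute)
  {
    assume xQ: "separating M ?Q x"
    show "separating M P y"
      unfolding separating_def
    proof (intro allI impI)
      fix w :: "nat \<Rightarrow> complex" and r
      assume w: "\<forall>k\<in>P. (\<Sum>r<M. w r * y k $ r) = 0" and r: "r < M"
      \<comment> \<open>Contracting \<open>orth\<close> with \<open>w\<close> gives a relation among
        all \<open>x i\<close> with coefficients \<open>c i\<close>; the terms in \<open>P\<close>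
        vanish by the choice of \<open>w\<close>.\<close>
      define c where "c i = d i * (\<Sum>s<M. w s * y i $ s)" for i
      have "(\<Sum>i\<in>?Q. c i * x i $ r) = 0" if r: "r < M" for r
      proof -
        have "(\<Sum>i<2 * M. c i * x i $ r) = (\<Sum>i<2 * M. \<Sum>s<M. w s * (d i * x i $ r * y i $ s))"
          by (simp add: c_def sum_distrib_left sum_distrib_right mult_ac)
        also have "\<dots> = (\<Sum>s<M. w s * (\<Sum>i<2 * M. d i * x i $ r * y i $ s))"
          unfolding sum_distrib_left by (rule sum.swap)
        also have "\<dots> = 0" using orth r by simp
        finally show ?thesis using w split[of "\<lambda>i. c i * x i $ r"] by (simp add: c_def)
      qed
      then have "c i = 0" if "i \<in> ?Q" for i
        using separating_imp_independent[OF xQ fin(2) cQ _ that] by blast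
      then have "(\<Sum>s<M. w s * y i $ s) = 0" if "i < 2 * M" for i
        using that d[OF that] w by (cases "i \<in> P") (auto simp: c_def)
      then show "w r = 0" using separatingD[OF y _ r] by simp
    qed
  }
  {
    assume yP: "separating M P y"
    show "separating M ?Q x"
      unfolding separating_def
    proof (intro allI impI)
      fix w :: "nat \<Rightarrow> complex" and r
      assume w: "\<forall>k\<in>?Q. (\<Sum>r<M. w r * x k $ r) = 0" and r: "r < M"
      \<comment> \<open>Contraction on the other side gives a relation among the \<open>y i\<close>,
        of which only the terms in \<open>P\<close> survive.\<close>
      define c where "c i = d i * (\<Sum>s<M. w s * x i $ s)" for i
      have "(\<Sum>i\<in>P. c i * y i $ r) = 0" if r: "r < M" for r
      proof -
        have "(\<Sum>i<2 * M. c i * y i $ r) = (\<Sum>i<2 * M. \<Sum>s<M. w s * (d i * x i $ s * y i $ r))"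
          by (simp add: c_def sum_distrib_left sum_distrib_right mult_ac)
        also have "\<dots> = (\<Sum>s<M. w s * (\<Sum>i<2 * M. d i * x i $ s * y i $ r))"
          unfolding sum_distrib_left by (rule sum.swap)
        also have "\<dots> = 0" using orth r by simp
        finally show ?thesis using w split[of "\<lambda>i. c i * y i $ r"] by (simp add: c_def)
      qed
      then have c0: "c i = 0" if "i \<in> P" for i
        using separating_imp_independent[OF yP fin(1) P(2) _ that] by blast
      have "(\<Sum>s<M. w s * x i $ s) = 0" if "i \<in> P" for i
        using c0[OF that] d[of i] that P(1) by (auto simp: c_def)
      then show "w r = 0" using separatingD[OF xP _ r] by simp
    qed
  }
qed

section \<open>Residues of the inverse of a matrix polynomial\<close>

text \<open>The sum is the coefficient of degree \<open>card S - 1\<close> in the Lagrange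
  interpolation polynomial \<open>L\<close> of \<open>f\<close>. Since \<open>f\<close> has smaller
  degree, \<open>L = f\<close> and that coefficient is zero. This is the residue theorem for a
  rational function with simple poles.\<close>

lemma sum_poly_over_node_products:
  fixes f :: "'a::field poly"
  assumes S: "finite S" "inj_on t S" and f: "degree f + 1 < card S"
  shows "(\<Sum>i\<in>S. poly f (t i) / (\<Prod>j\<in>S - {i}. t i - t j)) = 0"
proof -
  define n where "n = card S - 1"
  define N where "N i = (\<Prod>j\<in>S - {i}. [:- t j, 1:])" for i
  define L where "L = (\<Sum>i\<in>S. smult (poly f (t i) / (\<Prod>j\<in>S - {i}. t i - t j)) (N i))"
  have pN: "poly (N i) a = (\<Prod>j\<in>S - {i}. a - t j)" for i a
    by (simp add: N_def poly_prod)
  have dN: "degree (N i) = n" if "i \<in> S" for i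
    using that S by (simp add: N_def n_def degree_prod_eq_sum_degree)
  have cN: "coeff (N i) n = 1" if "i \<in> S" for i
    using lead_coeff_prod[of "\<lambda>j. [:- t j, 1:]" "S - {i}"] dN[OF that] by (simp add: N_def)
  have nz: "(\<Prod>j\<in>S - {i}. t i - t j) \<noteq> 0" if "i \<in> S" for i
    using S that by (auto simp: inj_on_def)
  have "poly L (t k) = poly f (t k)" if k: "k \<in> S" for k
  proof -
    have "poly L (t k) = (\<Sum>i\<in>S. if i = k then poly f (t k) else 0)"
      unfolding L_def poly_sum
    proof (rule sum.cong)
      fix i assume i: "i \<in> S"
      have "(\<Prod>j\<in>S - {i}. t k - t j) = 0" if "i \<noteq> k" using k S(1) that by auto
      then show "poly (smult (poly f (t i) / (\<Prod>j\<in>S - {i}. t i - t j)) (N i)) (t k) =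
        (if i = k then poly f (t k) else 0)"
        using nz[OF i] by (auto simp: pN)
    qed simp
    then show ?thesis using k S(1) by simp
  qed
  moreover have "degree L \<le> n"
    unfolding L_def using S(1) dN
    by (intro degree_sum_le) (auto intro: order.trans[OF degree_smult_le])
  moreover have "card (t ` S) = card S" using S by (simp add: card_image)
  ultimately have "L = f"
    using f by (intro poly_eqI_degree[of "t ` S"]) (auto simp: n_def)
  then have "coeff L n = 0" using f by (simp add: coeff_eq_0 n_def)
  then show ?thesis by (simp add: L_def coeff_sum cN)
qed

section \<open>Adjugates of matrices of corank one\<close>

lemma mat_delete_transpose:
  assumes "A \<in> carrier_mat n n"
  shows "mat_delete A\<^sup>T i j = (mat_delete A j i)\<^sup>T"
  using assms by (intro eq_matI) (auto simp: mat_delete_def)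

lemma adj_mat_transpose:
  assumes A: "A \<in> carrier_mat n n" and "i < n" "j < n"
  shows "adj_mat A\<^sup>T $$ (i, j) = adj_mat A $$ (j, i)"
proof -
  have "det (mat_delete A\<^sup>T j i) = det (mat_delete A i j)"
    unfolding mat_delete_transpose[OF A] by (rule det_transpose[OF mat_delete_carrier[OF A]])
  then show ?thesis using assms by (simp add: adj_mat_def cofactor_def add.commute)
qed

text \<open>Replacing row \<open>j\<close> by the unit row \<open>i\<close> gives a matrix
  \<open>B\<close> whose determinant is the cofactor \<open>adj_mat A $$ (i, j)\<close>. As
  \<open>z i = 0\<close>, the vector \<open>z\<close> lies in the kernel of
  \<open>B\<close>.\<close>

lemma kernel_eq_0_if_adj_mat_ne_0:
  fixes A :: "'a::field mat"
  assumes A: "A \<in> carrier_mat n n" and ij: "i < n" "j < n" and adj: "adj_mat A $$ (i, j) \<noteq> 0"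
    and z: "\<And>r. r < n \<Longrightarrow> (\<Sum>s<n. A $$ (r, s) * z s) = 0" and zi: "z i = 0" and s: "s < n"
  shows "z s = 0"
proof (rule ccontr)
  assume zs: "z s \<noteq> 0"
  define B where "B = mat n n (\<lambda>(r, s). if r = j then (if s = i then 1 else 0) else A $$ (r, s))"
  have B: "B \<in> carrier_mat n n" by (simp add: B_def)
  have "mat_delete B j i = mat_delete A j i"
    using A ij by (intro eq_matI) (auto simp: mat_delete_def B_def)
  then have "cofactor B j i = adj_mat A $$ (i, j)"
    using A ij by (simp add: adj_mat_def cofactor_def)
  moreover have "det B = (\<Sum>k<n. B $$ (j, k) * cofactor B j k)"
    by (rule laplace_expansion_row[OF B ij(2)])
  moreover have "\<dots> = (\<Sum>k<n. if k = i then cofactor B j k else 0)"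
    using ij by (intro sum.cong) (auto simp: B_def)
  ultimately have "det B \<noteq> 0" using ij adj by simp
  moreover have "(\<Sum>s<n. B $$ (r, s) * z s) = 0" if r: "r < n" for r
  proof (cases "r = j")
    case True
    then show ?thesis using r zi by (intro sum.neutral) (auto simp: B_def)
  next
    case False
    then show ?thesis using z[OF r] r by (simp add: B_def)
  qed
  ultimately show False using det_eq_0_iff_kernel[OF B] zs s by blast
qed

text \<open>Subtracting the multiple of \<open>v\<close> that cancels coordinate \<open>i\<close> of
  \<open>w\<close> leaves a kernel vector to which the previous lemma applies.\<close>

lemma kernel_one_dimensional:
  fixes A :: "'a::field mat"
  assumes A: "A \<in> carrier_mat n n" and ij: "i < n" "j < n" and adj: "adj_mat A $$ (i, j) \<noteq> 0"
    and v: "\<And>r. r < n \<Longrightarrow> (\<Sum>s<n. A $$ (r, s) * v s) = 0" and vk: "k < n" "v k \<noteq> 0"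
    and w: "\<And>r. r < n \<Longrightarrow> (\<Sum>s<n. A $$ (r, s) * w s) = 0"
  shows "v i \<noteq> 0 \<and> (\<forall>s<n. w s = w i / v i * v s)"
proof -
  have vi: "v i \<noteq> 0"
    using kernel_eq_0_if_adj_mat_ne_0[OF A ij adj v _ vk(1)] vk(2) by blast
  have "(\<lambda>s. w s - w i / v i * v s) s = 0" if s: "s < n" for s
  proof (rule kernel_eq_0_if_adj_mat_ne_0[OF A ij adj _ _ s])
    fix r assume r: "r < n"
    have "(\<Sum>s<n. A $$ (r, s) * (w s - w i / v i * v s)) =
      (\<Sum>s<n. A $$ (r, s) * w s) - w i / v i * (\<Sum>s<n. A $$ (r, s) * v s)"
      by (simp add: algebra_simps sum_subtractf sum_distrib_left)
    then show "(\<Sum>s<n. A $$ (r, s) * (w s - w i / v i * v s)) = 0" using v[OF r] w[OF r] by simp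
  qed (use vi in simp)
  then show ?thesis using vi by simp
qed

text \<open>Since \<open>det A = 0\<close>, both products of \<open>A\<close> with its adjugate
  vanish: columns of the adjugate lie in the right kernel, rows in the left one, and both kernels
  are lines. The nonzero entry at \<open>(i, j)\<close> fixes \<open>c\<close>.\<close>

lemma adj_mat_rank_one:
  fixes A :: "'a::field mat"
  assumes A: "A \<in> carrier_mat n n" and ij: "i < n" "j < n" and adj: "adj_mat A $$ (i, j) \<noteq> 0"
    and v: "\<And>r. r < n \<Longrightarrow> (\<Sum>s<n. A $$ (r, s) * v s) = 0" and vk: "k < n" "v k \<noteq> 0"
    and u: "\<And>s. s < n \<Longrightarrow> (\<Sum>r<n. A $$ (r, s) * u r) = 0" and uk: "k' < n" "u k' \<noteq> 0"
  shows "\<exists>c. c \<noteq> 0 \<and> (\<forall>r<n. \<forall>s<n. adj_mat A $$ (r, s) = c * v r * u s)"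
proof -
  have det0: "det A = 0" using det_eq_0_iff_kernel[OF A] v vk by blast
  note aA = adj_mat[OF A]
  have right: "(\<Sum>s<n. A $$ (r, s) * adj_mat A $$ (s, q)) = 0" if "r < n" "q < n" for r q
  proof -
    have "(\<Sum>s<n. A $$ (r, s) * adj_mat A $$ (s, q)) = (A * adj_mat A) $$ (r, q)"
      using A aA(1) that by (simp add: scalar_prod_def atLeast0LessThan)
    then show ?thesis using aA(2) det0 that by simp
  qed
  have left: "(\<Sum>r<n. A $$ (r, s) * adj_mat A $$ (q, r)) = 0" if "s < n" "q < n" for s q
  proof -
    have "(\<Sum>r<n. A $$ (r, s) * adj_mat A $$ (q, r)) = (adj_mat A * A) $$ (q, s)"
      using A aA(1) that by (simp add: scalar_prod_def atLeast0LessThan mult.commute)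
    then show ?thesis using aA(3) det0 that by simp
  qed
  have col: "v i \<noteq> 0" "\<And>r q. r < n \<Longrightarrow> q < n \<Longrightarrow> adj_mat A $$ (r, q) = adj_mat A $$ (i, q) / v i * v r"
    using kernel_one_dimensional[OF A ij adj v vk right] uk by blast+
  have AT: "A\<^sup>T \<in> carrier_mat n n" using A by simp
  have adjT: "adj_mat A\<^sup>T $$ (j, i) \<noteq> 0" using adj_mat_transpose[OF A ij(2,1)] adj by simp
  have uT: "(\<Sum>s<n. A\<^sup>T $$ (r, s) * u s) = 0" if "r < n" for r
    using u[OF that] that A by simp
  have "(\<Sum>s<n. A\<^sup>T $$ (r, s) * adj_mat A $$ (i, s)) = 0" if "r < n" for r
    using left[OF that ij(1)] that A by simp
  from kernel_one_dimensional[OF AT ij(2,1) adjT uT uk this]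
  have row: "u j \<noteq> 0" "\<And>s. s < n \<Longrightarrow> adj_mat A $$ (i, s) = adj_mat A $$ (i, j) / u j * u s"
    by blast+
  show ?thesis
  proof (intro exI[of _ "adj_mat A $$ (i, j) / (u j * v i)"] conjI allI impI)
    fix r s assume rs: "r < n" "s < n"
    show "adj_mat A $$ (r, s) = adj_mat A $$ (i, j) / (u j * v i) * v r * u s"
      using col(2)[OF rs] row(2)[OF rs(2)] by simp
  qed (use adj row(1) col(1) in simp)
qed

section \<open>Adjugates of polynomial matrices\<close>

lemma poly_adj_mat:
  fixes A :: "'a::comm_ring_1 poly mat"
  assumes A: "A \<in> carrier_mat n n" and "i < n" "j < n"
  shows "poly (adj_mat A $$ (i, j)) a = adj_mat (map_mat (\<lambda>p. poly p a) A) $$ (i, j)"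
proof -
  interpret comm_ring_hom "\<lambda>p. poly p a" by unfold_locales auto
  have "mat_delete (map_mat (\<lambda>p. poly p a) A) j i = map_mat (\<lambda>p. poly p a) (mat_delete A j i)"
    using assms by (intro eq_matI) (auto simp: mat_delete_def)
  then show ?thesis using assms by (simp add: adj_mat_def cofactor_def hom_det poly_power)
qed

lemma degree_adj_mat_le:
  fixes A :: "'a::comm_ring_1 poly mat"
  assumes A: "A \<in> carrier_mat n n" and ij: "i < n" "j < n"
    and deg: "\<And>r s. r < n \<Longrightarrow> s < n \<Longrightarrow> degree (A $$ (r, s)) \<le> k"
  shows "degree (adj_mat A $$ (i, j)) \<le> k * (n - 1)"
proof -
  have "degree (det (mat_delete A j i)) \<le> k * (n - 1)"
    using A ij deg by (intro degree_det_le mat_delete_carrier[OF A]) (auto simp: mat_delete_def)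
  moreover have "adj_mat A $$ (i, j) = det (mat_delete A j i) \<or>
    adj_mat A $$ (i, j) = - det (mat_delete A j i)"
    using A ij by (cases "even (i + j)") (auto simp: adj_mat_def cofactor_def add.commute)
  ultimately show ?thesis by auto
qed

text \<open>\<open>u\<^sup>T A adj A = det A u\<^sup>T\<close>: if \<open>adj A\<close> vanished at \<open>a\<close>, both factors on the left would
  be divisible by \<open>X - a\<close>.\<close>

lemma adj_mat_ne_0_at_simple_root:
  fixes A :: "'a::field poly mat"
  assumes A: "A \<in> carrier_mat n n" and simple: "\<not> [:- a, 1:] ^ 2 dvd det A"
    and u: "\<And>s. s < n \<Longrightarrow> (\<Sum>r<n. poly (A $$ (r, s)) a * u r) = 0" and uk: "k < n" "u k \<noteq> 0"
  shows "\<exists>i<n. \<exists>j<n. poly (adj_mat A $$ (i, j)) a \<noteq> 0"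
proof (rule ccontr)
  assume "\<not> ?thesis"
  then have adj: "[:- a, 1:] dvd adj_mat A $$ (i, k)" if "i < n" for i
    using that uk(1) by (simp add: poly_eq_0_iff_dvd)
  have left: "[:- a, 1:] dvd (\<Sum>r<n. smult (u r) (A $$ (r, s)))" if "s < n" for s
    using u[OF that] by (simp add: poly_eq_0_iff_dvd[symmetric] poly_sum mult.commute)
  note aA = adj_mat[OF A]
  have eq: "(\<Sum>s<n. A $$ (r, s) * adj_mat A $$ (s, k)) = (if r = k then det A else 0)" if "r < n" for r
  proof -
    have "(\<Sum>s<n. A $$ (r, s) * adj_mat A $$ (s, k)) = (A * adj_mat A) $$ (r, k)"
      using A aA(1) that uk by (simp add: scalar_prod_def atLeast0LessThan)
    then show ?thesis using aA(2) that uk by simp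
  qed
  have smult_sum: "smult c (\<Sum>s<n. g s) = (\<Sum>s<n. smult c (g s))" for c and g :: "nat \<Rightarrow> 'a poly"
    by (induction n) (simp_all add: smult_add_right)
  \<comment> \<open>Entry \<open>k\<close> of the identity, computed in both orders of
    multiplication; \<open>u k\<close> is nonzero, so divisibility passes to
    \<open>det A\<close>.\<close>
  have "(\<Sum>s<n. (\<Sum>r<n. smult (u r) (A $$ (r, s))) * adj_mat A $$ (s, k)) =
    (\<Sum>s<n. \<Sum>r<n. smult (u r) (A $$ (r, s) * adj_mat A $$ (s, k)))"
    by (simp add: sum_distrib_right)
  also have "\<dots> = (\<Sum>r<n. \<Sum>s<n. smult (u r) (A $$ (r, s) * adj_mat A $$ (s, k)))"
    by (rule sum.swap)
  also have "\<dots> = (\<Sum>r<n. smult (u r) (if r = k then det A else 0))"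
    by (intro sum.cong) (auto simp flip: eq smult_sum)
  also have "\<dots> = (\<Sum>r<n. if r = k then smult (u k) (det A) else 0)"
    by (intro sum.cong) auto
  also have "\<dots> = smult (u k) (det A)" using uk(1) by simp
  finally have eq': "(\<Sum>s<n. (\<Sum>r<n. smult (u r) (A $$ (r, s))) * adj_mat A $$ (s, k)) =
    smult (u k) (det A)" .
  have "[:- a, 1:] ^ 2 dvd smult (u k) (det A)"
    unfolding eq'[symmetric] power2_eq_square
    by (intro dvd_sum mult_dvd_mono left adj) simp_all
  then show False using simple uk(2) by (simp add: dvd_smult_iff)
qed

section \<open>Matrix polynomials with a full set of distinct finite eigenvalues\<close>

locale simple_eigenpairs =
  fixes m l M :: nat and A :: "complex poly mat" and t :: "nat \<Rightarrow> complex"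
    and v u :: "nat \<Rightarrow> complex vec"
  assumes m: "m \<ge> 1" and l: "l \<ge> 1" and M: "M = m * l"
    and A: "A \<in> carrier_mat l l"
    and deg: "\<And>r s. r < l \<Longrightarrow> s < l \<Longrightarrow> degree (A $$ (r, s)) \<le> 2 * m"
    and det: "det A \<noteq> 0"
    and t: "inj_on t {..<2 * M}"
    and v: "\<And>i. i < 2 * M \<Longrightarrow> v i \<in> carrier_vec l \<and> v i \<noteq> 0\<^sub>v l"
    and u: "\<And>i. i < 2 * M \<Longrightarrow> u i \<in> carrier_vec l \<and> u i \<noteq> 0\<^sub>v l"
    and Av: "\<And>i r. i < 2 * M \<Longrightarrow> r < l \<Longrightarrow> (\<Sum>s<l. poly (A $$ (r, s)) (t i) * v i $ s) = 0"
    and Au: "\<And>i s. i < 2 * M \<Longrightarrow> s < l \<Longrightarrow> (\<Sum>r<l. poly (A $$ (r, s)) (t i) * u i $ r) = 0"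
begin

lemma v_nz: "i < 2 * M \<Longrightarrow> \<exists>k<l. v i $ k \<noteq> 0"
  using v[of i] by (metis carrier_vecD eq_vecI index_zero_vec)

lemma u_nz: "i < 2 * M \<Longrightarrow> \<exists>k<l. u i $ k \<noteq> 0"
  using u[of i] by (metis carrier_vecD eq_vecI index_zero_vec)

lemma det_root: "i < 2 * M \<Longrightarrow> poly (det A) (t i) = 0"
proof -
  assume i: "i < 2 * M"
  interpret comm_ring_hom "\<lambda>p. poly p (t i)" by unfold_locales auto
  have "det (map_mat (\<lambda>p. poly p (t i)) A) = 0"
    using A v_nz[OF i] Av[OF i]
    by (subst det_eq_0_iff_kernel[of _ l]) (auto intro!: exI[of _ "\<lambda>s. v i $ s"])
  then show ?thesis by (simp add: hom_det)
qed

lemma card_nodes: "card (t ` {..<2 * M}) = 2 * M"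
  using t by (simp add: card_image)

lemma M_pos: "M > 0"
  using m l M by simp

text \<open>There are as many nodes as the bound \<open>2 * m * l\<close> on the degree of
  \<open>det A\<close>. Removing one factor of a double root would leave a nonzero polynomial of
  degree below \<open>2 * M\<close> that still vanishes at all nodes.\<close>

lemma simple_root:
  assumes i: "i < 2 * M"
  shows "\<not> [:- t i, 1:] ^ 2 dvd det A"
proof
  assume "[:- t i, 1:] ^ 2 dvd det A"
  then obtain q where q: "det A = [:- t i, 1:] ^ 2 * q" by (elim dvdE)
  define p where "p = [:- t i, 1:] * q"
  have dA: "det A = [:- t i, 1:] * p" unfolding q p_def power2_eq_square by (rule mult.assoc)
  have p0: "p \<noteq> 0" using dA det by auto
  have "degree (det A) = degree p + 1"
    unfolding dA using p0 by (subst degree_mult_eq) auto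
  moreover have "degree (det A) \<le> 2 * m * l" by (rule degree_det_le[OF deg A])
  ultimately have dp: "degree p < 2 * M" using M by simp
  have "poly p (t j) = 0" if "j < 2 * M" for j
    using det_root[OF that] by (auto simp: q p_def)
  then have "p = 0"
    using dp by (intro poly_eqI_degree[of "t ` {..<2 * M}"]) (auto simp: card_nodes)
  then show False using p0 by simp
qed

lemma adj_mat_at_node:
  assumes i: "i < 2 * M"
  shows "\<exists>c. c \<noteq> 0 \<and>
    (\<forall>r<l. \<forall>s<l. poly (adj_mat A $$ (r, s)) (t i) = c * v i $ r * u i $ s)"
proof -
  let ?B = "map_mat (\<lambda>p. poly p (t i)) A"
  have B: "?B \<in> carrier_mat l l" using A by simp
  obtain k where k: "k < l" "v i $ k \<noteq> 0" using v_nz[OF i] by blast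
  obtain k' where k': "k' < l" "u i $ k' \<noteq> 0" using u_nz[OF i] by blast
  obtain a b where ab: "a < l" "b < l" "poly (adj_mat A $$ (a, b)) (t i) \<noteq> 0"
    using adj_mat_ne_0_at_simple_root[OF A simple_root[OF i] Au[OF i] k'] by blast
  have adj: "adj_mat ?B $$ (a, b) \<noteq> 0" using ab poly_adj_mat[OF A] by simp
  have "\<exists>c. c \<noteq> 0 \<and> (\<forall>r<l. \<forall>s<l. adj_mat ?B $$ (r, s) = c * v i $ r * u i $ s)"
    by (rule adj_mat_rank_one[where v = "\<lambda>s. v i $ s" and u = "\<lambda>s. u i $ s", OF B ab(1,2) adj _ k _ k'])
       (use A Av[OF i] Au[OF i] in auto)
  then show ?thesis using poly_adj_mat[OF A] by simp
qed

text \<open>The bound \<open>2 * m * (l - 1)\<close> for minors of size \<open>l - 1\<close>, in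
  additive form to avoid truncated subtraction.\<close>

lemma degree_adj: "r < l \<Longrightarrow> s < l \<Longrightarrow> degree (adj_mat A $$ (r, s)) + 2 * m \<le> 2 * M"
proof -
  assume rs: "r < l" "s < l"
  have "degree (adj_mat A $$ (r, s)) + 2 * m \<le> 2 * m * (l - 1) + 2 * m"
    using degree_adj_mat_le[OF A rs deg] by simp
  also have "\<dots> = 2 * m * (l - 1 + 1)" by (simp only: distrib_left mult_1_right)
  also have "\<dots> = 2 * M" using l M by simp
  finally show ?thesis .
qed

text \<open>The residues of \<open>f A\<^sup>-\<^sup>1 = f adj A / det A\<close> at the simple roots are multiples of
  \<open>f (t i) v i (u i)\<^sup>T\<close>, and they sum to zero since \<open>f A\<^sup>-\<^sup>1\<close> is of order at least two at infinity.\<close>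

lemma residue_sum_zero:
  obtains d where "\<And>i. i < 2 * M \<Longrightarrow> d i \<noteq> 0"
    and "\<And>f r s. degree f + 2 \<le> 2 * m \<Longrightarrow> r < l \<Longrightarrow> s < l \<Longrightarrow>
      (\<Sum>i<2 * M. d i * poly f (t i) * v i $ r * u i $ s) = 0"
proof -
  obtain c where c: "\<And>i. i < 2 * M \<Longrightarrow> c i \<noteq> 0"
    "\<And>i r s. i < 2 * M \<Longrightarrow> r < l \<Longrightarrow> s < l \<Longrightarrow>
      poly (adj_mat A $$ (r, s)) (t i) = c i * v i $ r * u i $ s"
    using adj_mat_at_node by metis
  \<comment> \<open>As \<open>det A\<close> is a constant multiple of the node polynomial, whose
    derivative at \<open>t i\<close> is this product, the \<open>d i\<close> are the residue factors
    up to a common constant.\<close>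
  define d where "d i = c i / (\<Prod>j\<in>{..<2 * M} - {i}. t i - t j)" for i
  show thesis
  proof (rule that[of d])
    fix i assume "i < 2 * M"
    then show "d i \<noteq> 0" using c(1) t by (auto simp: d_def inj_on_def)
  next
    fix f :: "complex poly" and r s
    assume f: "degree f + 2 \<le> 2 * m" and rs: "r < l" "s < l"
    let ?g = "f * adj_mat A $$ (r, s)"
    have "degree ?g + 1 < 2 * M"
      using degree_mult_le[of f "adj_mat A $$ (r, s)"] degree_adj[OF rs] f by linarith
    then have "(\<Sum>i<2 * M. poly ?g (t i) / (\<Prod>j\<in>{..<2 * M} - {i}. t i - t j)) = 0"
      by (intro sum_poly_over_node_products t) auto
    also have "(\<Sum>i<2 * M. poly ?g (t i) / (\<Prod>j\<in>{..<2 * M} - {i}. t i - t j)) =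
      (\<Sum>i<2 * M. d i * poly f (t i) * v i $ r * u i $ s)"
      by (intro sum.cong) (auto simp: d_def c(2)[OF _ rs])
    finally show "(\<Sum>i<2 * M. d i * poly f (t i) * v i $ r * u i $ s) = 0" .
  qed
qed

text \<open>\<open>adj A W\<close> vanishes at all \<open>2 M\<close> nodes but has smaller degree, so \<open>det A W = A adj A W = 0\<close>.\<close>

lemma left_eigenvectors_separate:
  assumes W: "\<And>s. s < l \<Longrightarrow> degree (W s) < m"
    and z: "\<And>i. i < 2 * M \<Longrightarrow> (\<Sum>s<l. u i $ s * poly (W s) (t i)) = 0" and k: "k < l"
  shows "W k = 0"
proof -
  note aA = adj_mat[OF A]
  define g where "g r = (\<Sum>s<l. adj_mat A $$ (r, s) * W s)" for r
  have g0: "g r = 0" if r: "r < l" for r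
  proof (rule poly_eqI_degree[of "t ` {..<2 * M}"])
    \<comment> \<open>The degree is at most \<open>(2 * M - 2 * m) + (m - 1)\<close>.\<close>
    have "degree (adj_mat A $$ (r, s) * W s) < 2 * M" if s: "s < l" for s
      using degree_mult_le[of "adj_mat A $$ (r, s)" "W s"] degree_adj[OF r s] W[OF s] by linarith
    then show "card (t ` {..<2 * M}) > degree (g r)"
      unfolding g_def card_nodes using M_pos by (intro degree_sum_less) auto
    show "card (t ` {..<2 * M}) > degree (0 :: complex poly)" using M_pos card_nodes by simp
    fix a assume "a \<in> t ` {..<2 * M}"
    then obtain i where i: "i < 2 * M" "a = t i" by auto
    obtain c where c: "\<And>s. s < l \<Longrightarrow> poly (adj_mat A $$ (r, s)) (t i) = c * v i $ r * u i $ s"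
      using adj_mat_at_node[OF i(1)] r by blast
    have "poly (g r) (t i) = c * v i $ r * (\<Sum>s<l. u i $ s * poly (W s) (t i))"
      by (simp add: g_def poly_sum c sum_distrib_left mult_ac)
    then show "poly (g r) a = poly 0 a" using z[OF i(1)] i(2) by simp
  qed
  have "(\<Sum>r<l. A $$ (k, r) * adj_mat A $$ (r, s)) = (if s = k then det A else 0)" if "s < l" for s
  proof -
    have "(\<Sum>r<l. A $$ (k, r) * adj_mat A $$ (r, s)) = (A * adj_mat A) $$ (k, s)"
      using A aA(1) that k by (simp add: scalar_prod_def atLeast0LessThan)
    then show ?thesis using aA(2) that k by simp
  qed
  then have "(\<Sum>s<l. (\<Sum>r<l. A $$ (k, r) * adj_mat A $$ (r, s)) * W s) =
    (\<Sum>s<l. if s = k then det A * W k else 0)"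
    by (intro sum.cong) auto
  also have "\<dots> = det A * W k" using k by simp
  also have "(\<Sum>s<l. (\<Sum>r<l. A $$ (k, r) * adj_mat A $$ (r, s)) * W s) = (\<Sum>r<l. A $$ (k, r) * g r)"
    unfolding g_def sum_distrib_left sum_distrib_right mult.assoc by (rule sum.swap)
  finally show ?thesis using g0 det by simp
qed

end

section \<open>The pencil in an affine coordinate\<close>

text \<open>At the zero \<open>- p\<close> of the first form only the term \<open>i = 0\<close>
  survives, and the second form is nonzero there, so \<open>w 0 = 0\<close>. Cancelling the first
  form reduces \<open>n\<close> by one.\<close>

lemma linear_forms_independent:
  fixes p q c :: "'a::field"
  assumes cp: "c * p \<noteq> q"
    and z: "(\<Sum>i<n. smult (w i) ([:p, 1:] ^ i * [:q, c:] ^ (n - 1 - i))) = 0" and i: "i < n"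
  shows "w i = 0"
  using z i
proof (induction n arbitrary: w i)
  case (Suc n)
  let ?S = "\<Sum>i<n. smult (w (Suc i)) ([:p, 1:] ^ i * [:q, c:] ^ (n - 1 - i))"
  have "(\<Sum>i<Suc n. smult (w i) (f ^ i * g ^ (Suc n - 1 - i))) =
    smult (w 0) (g ^ n) + f * (\<Sum>i<n. smult (w (Suc i)) (f ^ i * g ^ (n - 1 - i)))"
    for f g :: "'a poly"
    unfolding sum.lessThan_Suc_shift by (simp add: sum_distrib_left mult.assoc)
  then have eq: "smult (w 0) ([:q, c:] ^ n) + [:p, 1:] * ?S = 0"
    using Suc.prems(1) by simp
  have "poly (smult (w 0) ([:q, c:] ^ n) + [:p, 1:] * ?S) (- p) = w 0 * (q - p * c) ^ n"
    by simp
  then have "w 0 * (q - p * c) ^ n = 0" unfolding eq by simp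
  then have w0: "w 0 = 0" using cp by (simp add: mult.commute)
  then have "[:p, 1:] * ?S = 0" using eq by (simp only: smult_0_left add_0_left)
  then have "[:p, 1:] = 0 \<or> ?S = 0" by (rule iffD1[OF mult_eq_0_iff])
  then have "?S = 0" by simp
  then show ?case using w0 Suc.IH[of "\<lambda>i. w (Suc i)"] Suc.prems(2) by (cases i) auto
qed simp

text \<open>For linear \<open>f\<close> and \<open>g\<close> this is the homogeneous pencil
  restricted to an affine line. As a polynomial matrix it treats the roots at zero and infinity like
  all others.\<close>

definition pencil_on_line ::
  "(int \<Rightarrow> complex mat) \<Rightarrow> nat \<Rightarrow> nat \<Rightarrow> complex \<Rightarrow> complex poly \<Rightarrow> complex poly \<Rightarrow> complex poly mat" where
  "pencil_on_line a m l E f g = mat l l (\<lambda>(r, s).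
     (if r = s then smult E (f ^ m * g ^ m) else 0)
     - (\<Sum>n = - int m..int m. smult (a n $$ (r, s)) (f ^ nat (int m + n) * g ^ nat (int m - n))))"

lemma poly_pencil_on_line:
  assumes "r < l" "s < l"
  shows "poly (pencil_on_line a m l E f g $$ (r, s)) \<tau> = pencil a m l E (poly f \<tau>) (poly g \<tau>) $$ (r, s)"
  using assms by (auto simp: pencil_on_line_def pencil_def poly_sum mult.assoc)

lemma degree_form_le:
  fixes f g :: "'a::comm_ring_1 poly"
  assumes "degree f \<le> 1" "degree g \<le> 1"
  shows "degree (f ^ i * g ^ j) \<le> i + j"
proof -
  have "degree (f ^ i) \<le> i" "degree (g ^ j) \<le> j"
    using degree_power_le[of f i] degree_power_le[of g j] assms
      mult_right_mono[OF assms(1), of i] mult_right_mono[OF assms(2), of j] by linarith+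
  then show ?thesis using degree_mult_le[of "f ^ i" "g ^ j"] by linarith
qed

lemma degree_pencil_on_line_le:
  assumes "degree f \<le> 1" "degree g \<le> 1" and rs: "r < l" "s < l"
  shows "degree (pencil_on_line a m l E f g $$ (r, s)) \<le> 2 * m"
proof -
  have "degree (f ^ nat (int m + n) * g ^ nat (int m - n)) \<le> 2 * m" if "n \<in> {- int m..int m}" for n
    using degree_form_le[OF assms(1,2), of "nat (int m + n)" "nat (int m - n)"] that by auto
  then have "degree (\<Sum>n = - int m..int m.
      smult (a n $$ (r, s)) (f ^ nat (int m + n) * g ^ nat (int m - n))) \<le> 2 * m"
    by (intro degree_sum_le) (auto intro: order.trans[OF degree_smult_le])
  moreover have "degree (if r = s then smult E (f ^ m * g ^ m) else 0) \<le> 2 * m"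
    using degree_form_le[OF assms(1,2), of m m] by (auto intro: order.trans[OF degree_smult_le])
  ultimately show ?thesis
    using rs by (simp add: pencil_on_line_def degree_diff_le)
qed

text \<open>The two exponents in every term add up to \<open>2 * m\<close>, so the kernel depends
  only on the projective point.\<close>

lemma pencil_scale:
  "pencil a m l E (k * s) (k * t) = k ^ (2 * m) \<cdot>\<^sub>m pencil a m l E s t"
proof (intro eq_matI)
  fix i j
  assume "i < dim_row (k ^ (2 * m) \<cdot>\<^sub>m pencil a m l E s t)" "j < dim_col (k ^ (2 * m) \<cdot>\<^sub>m pencil a m l E s t)"
  then have ij: "i < l" "j < l" by (simp_all add: pencil_def)
  have "a n $$ (i, j) * (k * s) ^ nat (int m + n) * (k * t) ^ nat (int m - n) =
    k ^ (2 * m) * (a n $$ (i, j) * s ^ nat (int m + n) * t ^ nat (int m - n))"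
    if "n \<in> {- int m..int m}" for n
  proof -
    have "nat (int m + n) + nat (int m - n) = 2 * m" using that by auto
    then have "k ^ (2 * m) = k ^ nat (int m + n) * k ^ nat (int m - n)"
      by (metis power_add)
    then show ?thesis by (simp add: power_mult_distrib mult_ac)
  qed
  then have "(\<Sum>n = - int m..int m. a n $$ (i, j) * (k * s) ^ nat (int m + n) * (k * t) ^ nat (int m - n)) =
    k ^ (2 * m) * (\<Sum>n = - int m..int m. a n $$ (i, j) * s ^ nat (int m + n) * t ^ nat (int m - n))"
    unfolding sum_distrib_left by (intro sum.cong) auto
  moreover have "k ^ m * k ^ m = k ^ (2 * m)" by (simp add: mult_2 power_add)
  then have "E * (k * s) ^ m * (k * t) ^ m = k ^ (2 * m) * (E * s ^ m * t ^ m)"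
    by (simp add: power_mult_distrib mult_ac flip: mult.assoc[of "k ^ m" "k ^ m"])
  ultimately show "pencil a m l E (k * s) (k * t) $$ (i, j) = (k ^ (2 * m) \<cdot>\<^sub>m pencil a m l E s t) $$ (i, j)"
    using ij by (simp add: pencil_def right_diff_distrib)
qed (simp_all add: pencil_def)

lemma pencil_carrier: "pencil a m l E s t \<in> carrier_mat l l"
  by (intro carrier_matI) (simp_all add: pencil_def)

lemma exists_direction:
  fixes S :: "('a::field_char_0 \<times> 'a) set"
  assumes "finite S" "(0, 0) \<notin> S"
  obtains c where "\<And>a b. (a, b) \<in> S \<Longrightarrow> c * a \<noteq> b"
proof -
  have "infinite (UNIV :: 'a set)" by (rule infinite_UNIV_char_0)
  \<comment> \<open>Points with \<open>a = 0\<close> contribute the default value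
    \<open>b / 0 = 0\<close>, which merely excludes one more slope.\<close>
  then obtain c where c: "c \<notin> (\<lambda>(a, b). b / a) ` S"
    using assms(1) by (metis finite_imageI ex_new_if_finite)
  show thesis
  proof (rule that)
    fix a b assume ab: "(a, b) \<in> S"
    show "c * a \<noteq> b"
    proof
      assume eq: "c * a = b"
      then have "a \<noteq> 0" using assms(2) ab by auto
      then have "c = b / a" using eq by (simp add: field_simps)
      then show False using c ab by force
    qed
  qed
qed

lemma sum_lessThan_mult:
  fixes g :: "nat \<Rightarrow> 'a::comm_monoid_add"
  shows "(\<Sum>j<m * l. g j) = (\<Sum>q<m. \<Sum>s<l. g (q * l + s))"
proof -
  have "(\<Sum>j<m * l. g j) = (\<Sum>q<m. \<Sum>j\<in>{q * l..<q * l + l}. g j)"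
    by (rule sum.nat_group[symmetric])
  also have "\<dots> = (\<Sum>q<m. \<Sum>s<l. g (q * l + s))"
  proof (rule sum.cong)
    show "(\<Sum>j\<in>{q * l..<q * l + l}. g j) = (\<Sum>s<l. g (q * l + s))" for q
      using sum.shift_bounds_nat_ivl[of g 0 "q * l" l] by (simp add: atLeast0LessThan add.commute)
  qed simp
  finally show ?thesis .
qed

theorem mainTheorem1:
  fixes m l M :: nat
    and a :: "int \<Rightarrow> complex mat"
    and E :: complex
    and lam mu :: "nat \<Rightarrow> complex"
    and v u x y :: "nat \<Rightarrow> complex vec"
    and P :: "nat set"
  assumes "m \<ge> 1" and "l \<ge> 1" and "M = m * l"
    and "\<And>n. - int m \<le> n \<Longrightarrow> n \<le> int m \<Longrightarrow> a n \<in> carrier_mat l l"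
    and "\<exists>s t. det (pencil a m l E s t) \<noteq> 0"
    and "\<And>i. i < 2 * M \<Longrightarrow> (lam i, mu i) \<noteq> (0, 0)"
    and "\<And>i. i < 2 * M \<Longrightarrow> det (pencil a m l E (lam i) (mu i)) = 0"
    and "\<And>i j. i < 2 * M \<Longrightarrow> j < 2 * M \<Longrightarrow> i \<noteq> j \<Longrightarrow> lam i * mu j \<noteq> lam j * mu i"
    and "\<And>i. i < 2 * M \<Longrightarrow> v i \<in> carrier_vec l \<and> v i \<noteq> 0\<^sub>v l"
    and "\<And>i. i < 2 * M \<Longrightarrow> pencil a m l E (lam i) (mu i) *\<^sub>v v i = 0\<^sub>v l"
    and "\<And>i. i < 2 * M \<Longrightarrow> u i \<in> carrier_vec l \<and> u i \<noteq> 0\<^sub>v l"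
    and "\<And>i. i < 2 * M \<Longrightarrow> transpose_mat (pencil a m l E (lam i) (mu i)) *\<^sub>v u i = 0\<^sub>v l"
    and "\<And>i. i < 2 * M \<Longrightarrow> x i = supercell_right m l (lam i) (mu i) (v i)"
    and "\<And>i. i < 2 * M \<Longrightarrow> y i = supercell_left m l (lam i) (mu i) (u i)"
    and "P \<subseteq> {..<2 * M}" and "card P = M"
  shows "boundary_coeff M x P \<noteq> 0 \<longleftrightarrow> det (outer_sum M P x y) \<noteq> 0"
proof -
  note m = assms(1) and l = assms(2) and M = assms(3)
    and roots = assms(6) and distinct = assms(8) and v = assms(9) and Qv = assms(10)
    and u = assms(11) and Qu = assms(12) and x = assms(13) and y = assms(14)
    and P = assms(15,16)
  let ?Q = "pencil a m l E"
  have entry_v: "(\<Sum>s<l. ?Q (lam i) (mu i) $$ (r, s) * v i $ s) = 0" if "i < 2 * M" "r < l" for i r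
  proof -
    have "(\<Sum>s<l. ?Q (lam i) (mu i) $$ (r, s) * v i $ s) = (?Q (lam i) (mu i) *\<^sub>v v i) $ r"
      using that carrier_vecD[OF conjunct1[OF v[OF that(1)]]] pencil_carrier[of a m l E "lam i" "mu i"]
      by (simp add: scalar_prod_def atLeast0LessThan)
    then show ?thesis using Qv[OF that(1)] that by simp
  qed
  have entry_u: "(\<Sum>r<l. ?Q (lam i) (mu i) $$ (r, s) * u i $ r) = 0" if "i < 2 * M" "s < l" for i s
  proof -
    have "(\<Sum>r<l. ?Q (lam i) (mu i) $$ (r, s) * u i $ r) = ((?Q (lam i) (mu i))\<^sup>T *\<^sub>v u i) $ s"
      using that carrier_vecD[OF conjunct1[OF u[OF that(1)]]] pencil_carrier[of a m l E "lam i" "mu i"]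
      by (simp add: scalar_prod_def atLeast0LessThan)
    then show ?thesis using Qu[OF that(1)] that by simp
  qed

  \<comment> \<open>Change of projective coordinate\<close>
  obtain p q where pq: "det (?Q p q) \<noteq> 0" using assms(5) by blast
  \<comment> \<open>Homogeneity with scale factor zero; it shows that \<open>(p, q)\<close> is not
    the origin.\<close>
  have "det (?Q 0 0) = 0"
  proof -
    have "det (?Q (0 * 0) (0 * 0)) = (0 ^ (2 * m)) ^ l * det (?Q 0 0)"
      unfolding pencil_scale det_smult by (simp add: pencil_def)
    moreover have "0 < m" "0 < l" using m l by simp_all
    ultimately show ?thesis by (simp add: power_0_left)
  qed
  then have pq0: "(p, q) \<noteq> (0, 0)" using pq by auto
  \<comment> \<open>On the line through \<open>(p, q)\<close> in a direction \<open>(1, c)\<close> different from all roots, every root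
    is represented by a finite parameter \<open>\<tau> i\<close>.\<close>
  obtain c where c: "\<And>i. i < 2 * M \<Longrightarrow> c * lam i \<noteq> mu i" "c * p \<noteq> q"
  proof -
    let ?S = "insert (p, q) ((\<lambda>i. (lam i, mu i)) ` {..<2 * M})"
    have "finite ?S" by simp
    moreover have "(0, 0) \<notin> ?S" using pq0 roots by force
    ultimately obtain c where "\<And>a b. (a, b) \<in> ?S \<Longrightarrow> c * a \<noteq> b"
      by (rule exists_direction) blast
    then show thesis by (intro that[of c]) auto
  qed
  \<comment> \<open>Solution of \<open>lam i = k i * (p + \<tau> i)\<close> and
    \<open>mu i = k i * (q + c * \<tau> i)\<close>: eliminating \<open>\<tau> i\<close> gives
    \<open>k i\<close>, the first equation then \<open>\<tau> i\<close>.\<close>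
  define k where "k i = (c * lam i - mu i) / (c * p - q)" for i
  define \<tau> where "\<tau> i = lam i / k i - p" for i
  have k: "k i \<noteq> 0" if "i < 2 * M" for i using c(1)[OF that] c(2) by (simp add: k_def)
  have lam: "lam i = k i * (p + \<tau> i)" if "i < 2 * M" for i
    using k[OF that] by (simp add: \<tau>_def)
  have mu: "mu i = k i * (q + c * \<tau> i)" if "i < 2 * M" for i
  proof -
    have "k i * (c * p - q) = c * lam i - mu i" using c(2) by (simp add: k_def)
    then have "mu i = c * lam i - k i * (c * p - q)" by simp
    then show ?thesis unfolding lam[OF that] by (simp add: algebra_simps)
  qed
  have inj: "inj_on \<tau> {..<2 * M}"
  proof (rule inj_onI, rule ccontr)
    fix i j assume ij: "i \<in> {..<2 * M}" "j \<in> {..<2 * M}" "\<tau> i = \<tau> j" "i \<noteq> j"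
    then have "lam i * mu j = lam j * mu i" by (simp add: lam mu)
    then show False using distinct ij by simp
  qed

  define f where "f = [:p, 1:]"
  define g where "g = [:q, c:]"
  have dfg: "degree f \<le> 1" "degree g \<le> 1" by (simp_all add: f_def g_def)
  define A where "A = pencil_on_line a m l E f g"
  have A: "A \<in> carrier_mat l l" by (simp add: A_def pencil_on_line_def)
  have line: "k i ^ (2 * m) * poly (A $$ (r, s)) (\<tau> i) = ?Q (lam i) (mu i) $$ (r, s)"
    if "i < 2 * M" "r < l" "s < l" for i r s
  proof -
    have "?Q (lam i) (mu i) = k i ^ (2 * m) \<cdot>\<^sub>m ?Q (p + \<tau> i) (q + c * \<tau> i)"
      using that(1) by (simp add: lam mu pencil_scale)
    then show ?thesis
      using that pencil_carrier[of a m l E "p + \<tau> i" "q + c * \<tau> i"]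
      by (simp add: A_def poly_pencil_on_line f_def g_def mult.commute)
  qed
  \<comment> \<open>The line passes through \<open>(p, q)\<close> at parameter zero, where the
    pencil is invertible.\<close>
  have "map_mat (\<lambda>p. poly p 0) A = ?Q p q"
    using A pencil_carrier[of a m l E p q]
    by (intro eq_matI) (auto simp: A_def poly_pencil_on_line f_def g_def)
  moreover interpret poly0: comm_ring_hom "\<lambda>p::complex poly. poly p 0" by unfold_locales auto
  have "det (map_mat (\<lambda>p. poly p 0) A) = poly (det A) 0" by (rule poly0.hom_det)
  ultimately have det: "det A \<noteq> 0" using pq by auto
  interpret simple_eigenpairs m l M A \<tau> v u
  proof
    show "degree (A $$ (r, s)) \<le> 2 * m" if "r < l" "s < l" for r s
      unfolding A_def by (rule degree_pencil_on_line_le[OF dfg that])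
    show "(\<Sum>s<l. poly (A $$ (r, s)) (\<tau> i) * v i $ s) = 0" if "i < 2 * M" "r < l" for i r
    proof -
      have "k i ^ (2 * m) * (\<Sum>s<l. poly (A $$ (r, s)) (\<tau> i) * v i $ s) = 0"
        using entry_v[OF that] line[OF that, symmetric]
        by (simp add: sum_distrib_left mult.assoc)
      then show ?thesis using k[OF that(1)] by simp
    qed
    show "(\<Sum>r<l. poly (A $$ (r, s)) (\<tau> i) * u i $ r) = 0" if "i < 2 * M" "s < l" for i s
    proof -
      have "k i ^ (2 * m) * (\<Sum>r<l. poly (A $$ (r, s)) (\<tau> i) * u i $ r) = 0"
        using entry_u[OF that] line[OF that(1) _ that(2), symmetric]
        by (simp add: sum_distrib_left mult.assoc)
      then show ?thesis using k[OF that(1)] by simp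
    qed
  qed (use m l M A det inj v u in auto)

  \<comment> \<open>Supercell vectors in the affine coordinate\<close>
  have block: "j div l \<le> m - 1" "j mod l < l" if "j < M" for j
    using that l M less_mult_imp_div_less[of j m l] by auto
  \<comment> \<open>The exponents in each block add up to \<open>m - 1\<close>, so passing to the
    affine coordinate scales the whole vector by one factor.\<close>
  have x_entry: "x i $ j = k i ^ (m - 1) *
      poly (f ^ (m - 1 - j div l) * g ^ (j div l)) (\<tau> i) * v i $ (j mod l)"
    if "i < 2 * M" "j < M" for i j
  proof -
    have "k i ^ (m - 1) = k i ^ (m - 1 - j div l) * k i ^ (j div l)"
      using block(1)[OF that(2)] by (simp only: le_add_diff_inverse2 flip: power_add)
    then show ?thesis
      using that M by (simp add: x supercell_right_def lam mu f_def g_def power_mult_distrib mult_ac)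
  qed
  have y_entry: "y i $ j = k i ^ (m - 1) *
      poly (f ^ (j div l) * g ^ (m - 1 - j div l)) (\<tau> i) * u i $ (j mod l)"
    if "i < 2 * M" "j < M" for i j
  proof -
    have "k i ^ (m - 1) = k i ^ (j div l) * k i ^ (m - 1 - j div l)"
      using block(1)[OF that(2)] by (simp only: le_add_diff_inverse flip: power_add)
    then show ?thesis
      using that M by (simp add: y supercell_left_def lam mu f_def g_def power_mult_distrib mult_ac)
  qed

  \<comment> \<open>Duality of right and left supercell vectors\<close>
  obtain d where d: "\<And>i. i < 2 * M \<Longrightarrow> d i \<noteq> 0"
    "\<And>h r s. degree h + 2 \<le> 2 * m \<Longrightarrow> r < l \<Longrightarrow> s < l \<Longrightarrow>
      (\<Sum>i<2 * M. d i * poly h (\<tau> i) * v i $ r * u i $ s) = 0"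
    using residue_sum_zero by blast
  \<comment> \<open>This absorbs the scale factors of \<open>x i\<close> and
    \<open>y i\<close>.\<close>
  define D where "D i = d i / (k i ^ (m - 1) * k i ^ (m - 1))" for i
  have D: "D i \<noteq> 0" if "i < 2 * M" for i using d(1)[OF that] k[OF that] by (simp add: D_def)
  have orth: "(\<Sum>i<2 * M. D i * x i $ r * y i $ s) = 0" if rs: "r < M" "s < M" for r s
  proof -
    \<comment> \<open>Each supercell vector contributes degree at most \<open>m - 1\<close>; the
      total \<open>2 * m - 2\<close> is the largest that the residue identity admits.\<close>
    let ?h = "(f ^ (m - 1 - r div l) * g ^ (r div l)) * (f ^ (s div l) * g ^ (m - 1 - s div l))"
    have "degree ?h \<le> (m - 1 - r div l + r div l) + (s div l + (m - 1 - s div l))"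
      using degree_mult_le degree_form_le[OF dfg] by (meson add_mono order.trans)
    then have "degree ?h + 2 \<le> 2 * m" using block(1)[OF rs(1)] block(1)[OF rs(2)] m by simp
    then have "(\<Sum>i<2 * M. d i * poly ?h (\<tau> i) * v i $ (r mod l) * u i $ (s mod l)) = 0"
      using d(2) block(2) rs by blast
    moreover have "D i * x i $ r * y i $ s = d i * poly ?h (\<tau> i) * v i $ (r mod l) * u i $ (s mod l)"
      if "i < 2 * M" for i
      using k[OF that] by (simp add: D_def x_entry[OF that rs(1)] y_entry[OF that rs(2)])
    ultimately show ?thesis by (simp add: power_0_left)
  qed

  \<comment> \<open>The left supercell vectors span\<close>
  have sep_y: "separating M {..<2 * M} y"
    unfolding separating_def
  proof (intro allI impI)
    fix w :: "nat \<Rightarrow> complex" and j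
    assume w: "\<forall>i\<in>{..<2 * M}. (\<Sum>r<M. w r * y i $ r) = 0" and j: "j < M"
    \<comment> \<open>Collecting the block index of \<open>w\<close> into polynomials turns its
      pairing with \<open>y i\<close> into the pairing of \<open>u i\<close> with \<open>W\<close>
      at \<open>\<tau> i\<close>, up to \<open>k i ^ (m - 1)\<close>.\<close>
    define W where "W s = (\<Sum>b<m. smult (w (b * l + s)) (f ^ b * g ^ (m - 1 - b)))" for s
    have "degree (smult (w (b * l + s)) (f ^ b * g ^ (m - 1 - b))) < m" if "b < m" for b s
    proof -
      have "degree (f ^ b * g ^ (m - 1 - b)) \<le> m - 1"
        using degree_form_le[OF dfg, of b "m - 1 - b"] that by simp
      then show ?thesis
        using degree_smult_le[of "w (b * l + s)" "f ^ b * g ^ (m - 1 - b)"] m by linarith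
    qed
    then have dW: "degree (W s) < m" for s
      unfolding W_def using m by (intro degree_sum_less) auto
    have "(\<Sum>s<l. u i $ s * poly (W s) (\<tau> i)) = 0" if i: "i < 2 * M" for i
    proof -
      have "k i ^ (m - 1) * (\<Sum>s<l. u i $ s * poly (W s) (\<tau> i)) =
        (\<Sum>s<l. \<Sum>b<m. w (b * l + s) * (k i ^ (m - 1) * poly (f ^ b * g ^ (m - 1 - b)) (\<tau> i) * u i $ s))"
        by (simp add: W_def poly_sum sum_distrib_left mult_ac)
      also have "\<dots> = (\<Sum>b<m. \<Sum>s<l. w (b * l + s) * (k i ^ (m - 1) * poly (f ^ b * g ^ (m - 1 - b)) (\<tau> i) * u i $ s))"
        by (rule sum.swap)
      also have "\<dots> = (\<Sum>b<m. \<Sum>s<l. w (b * l + s) * y i $ (b * l + s))"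
      proof (intro sum.cong refl)
        fix b s assume "b \<in> {..<m}" "s \<in> {..<l}"
        then have bs: "b < m" "s < l" by auto
        have "b * l + s < Suc b * l" using bs by simp
        also have "\<dots> \<le> M" using bs M by (simp only: mult_le_mono1 Suc_leI)
        finally show "w (b * l + s) * (k i ^ (m - 1) * poly (f ^ b * g ^ (m - 1 - b)) (\<tau> i) * u i $ s) =
          w (b * l + s) * y i $ (b * l + s)"
          using bs by (simp add: y_entry[OF i])
      qed
      also have "\<dots> = (\<Sum>r<M. w r * y i $ r)" by (simp add: M sum_lessThan_mult)
      finally show ?thesis using w i k[OF i] by simp
    qed
    then have "W (j mod l) = 0"
      using left_eigenvectors_separate[of W, OF dW _ block(2)[OF j]] by simp
    \<comment> \<open>Since \<open>c * p \<noteq> q\<close>, the forms \<open>f\<close> and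
      \<open>g\<close> are not proportional, so the coefficients of \<open>W\<close> can be read
      off.\<close>
    then have "w (j div l * l + j mod l) = 0"
      unfolding W_def f_def g_def using block(1)[OF j] m
      by (intro linear_forms_independent[OF c(2), of "\<lambda>b. w (b * l + j mod l)" m]) auto
    then show "w j = 0" by simp
  qed

  have fP: "finite P" using P(1) finite_subset by blast
  have xc: "x i \<in> carrier_vec M" if "i < 2 * M" for i
    using x[OF that] M by (simp add: supercell_right_def)
  have "boundary_coeff M x P \<noteq> 0 \<longleftrightarrow> separating M P x \<and> separating M ({..<2 * M} - P) x"
    by (rule boundary_coeff_ne_0_iff[OF xc P])
  \<comment> \<open>The comparison of complementary minors holds under
    \<open>separating M P x\<close>, which is a conjunct on both sides.\<close>
  also have "\<dots> \<longleftrightarrow> separating M P x \<and> separating M P y"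
    using separating_complement_iff[OF P D orth sep_y] by blast
  also have "\<dots> \<longleftrightarrow> det (outer_sum M P x y) \<noteq> 0"
    using det_outer_sum_ne_0_iff[OF fP P(2)] by blast
  finally show ?thesis .
qed

end
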